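(* Let $X$ be a metric space, $\varphi_1,\varphi_2\colon X\to\mathbb{R}_\infty$, and $U\subset X$ with $\operatorname{dom}\varphi_1\cap\operatorname{dom}\varphi_2\cap U\ne\emptyset$. Suppose that $(\varphi_1,\varphi_2)$ is firmly uniformly (resp., firmly quasiuniformly) lower semicontinuous on $U$ and $g\colon X\to\mathbb{R}$ is uniformly continuous on $U$. Then $(\varphi_1,\varphi_2+g)$ is firmly uniformly (resp., firmly quasiuniformly) lower semicontinuous on $U$.
   Context: $\mathbb{R}_\infty:=\mathbb{R}\cup\{+\infty\}$, $\operatorname{dom}\varphi:=\{x\mid\varphi(x)<+\infty\}$. A set $V\subset X$ is an essentially interior subset of $U$ if $\bigcup_{x\in V}B_\rho(x)\subset U$ for some $\rho>0$ ($B_\rho$ = open ball); $EI(U)$ is the collection of all such $V$. For $x_1\in\operatorname{dom}\varphi_1$, $x_2\in\operatorname{dom}\varphi_2$ put $$(\varphi_1\diamondsuit\varphi_2)_U(x_1,x_2):=\inf_{x\in U}\max\{d(x,x_1),\,d(x,x_2),\,(\varphi_1+\varphi_2)(x)-\varphi_1(x_1)-\varphi_2(x_2)\},$$ $$\Theta_U^\circ(\varphi_1,\varphi_2):=\limsup_{\substack{d(x_1,x_2)\to0\\ x_1\in\operatorname{dom}\varphi_1\cap U,\,x_2\in\operatorname{dom}\varphi_2\cap U}}(\varphi_1\diamondsuit\varphi_2)_U(x_1,x_2),$$ $$\Theta_U^\dagger(\varphi_1,\varphi_2):=\sup_{V\in EI(U)}\ \limsup_{\substack{d(x_1,x_2)\to0\\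 x_1\in\operatorname{dom}\varphi_1\cap V,\,x_2\in\operatorname{dom}\varphi_2\cap V}}(\varphi_1\diamondsuit\varphi_2)_U(x_1,x_2),$$ where each limsup is $\lim_{\eta\downarrow0}$ of the supremum over the indicated pairs with $d(x_1,x_2)<\eta$, and the supremum over an empty set is $0$. The pair is firmly uniformly lower semicontinuous on $U$ if $\Theta_U^\circ(\varphi_1,\varphi_2)=0$, and firmly quasiuniformly lower semicontinuous on $U$ if $\Theta_U^\dagger(\varphi_1,\varphi_2)=0$. *)

theory Defs
  imports "HOL-Analysis.Analysis"
begin

text \<open>
  Functions with values in \<open>\<real> \<union> {+\<infinity>}\<close> are functions into \<^typ>\<open>ereal\<close> that never
  take the value \<open>-\<infinity>\<close>; this is an explicit assumption where it is needed.
\<close>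

definition edom :: "('a \<Rightarrow> ereal) \<Rightarrow> 'a set" where
  "edom \<phi> = {x. \<phi> x < \<infinity>}"

definition EI :: "'a::metric_space set \<Rightarrow> 'a set set" where
  "EI U = {V. \<exists>\<rho>>0. (\<Union>x\<in>V. ball x \<rho>) \<subseteq> U}"

text \<open>The supremum of the empty set is \<open>0\<close> by convention, whereas \<open>Sup {} = -\<infinity>\<close> in \<^typ>\<open>ereal\<close>.\<close>

definition Sup0 :: "ereal set \<Rightarrow> ereal" where
  "Sup0 S = (if S = {} then 0 else Sup S)"

text \<open>
  Only used for \<open>x1 \<in> edom \<phi>1\<close>, \<open>x2 \<in> edom \<phi>2\<close>, so that the subtracted values are finite.
\<close>

definition diamond ::
    "('a::metric_space \<Rightarrow> ereal) \<Rightarrow> ('a \<Rightarrow> ereal) \<Rightarrow> 'a set \<Rightarrow> 'a \<Rightarrow> 'a \<Rightarrow> ereal" where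
  "diamond \<phi>1 \<phi>2 U x1 x2 =
     (INF x\<in>U. max (ereal (dist x x1)) (max (ereal (dist x x2))
        ((\<phi>1 x + \<phi>2 x) - \<phi>1 x1 - \<phi>2 x2)))"

text \<open>
  The limsup of \<open>(\<phi>1 \<diamondsuit> \<phi>2)\<^sub>U(x1,x2)\<close> as \<open>d(x1,x2) \<rightarrow> 0\<close> with
  \<open>x1 \<in> dom \<phi>1 \<inter> V\<close>, \<open>x2 \<in> dom \<phi>2 \<inter> V\<close>. The limit exists because the supremum is
  monotone in \<open>\<eta>\<close>.
\<close>

definition diamond_sup ::
    "('a::metric_space \<Rightarrow> ereal) \<Rightarrow> ('a \<Rightarrow> ereal) \<Rightarrow> 'a set \<Rightarrow> 'a set \<Rightarrow> real \<Rightarrow> ereal" where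
  "diamond_sup \<phi>1 \<phi>2 U V \<eta> =
     Sup0 {diamond \<phi>1 \<phi>2 U x1 x2 | x1 x2.
             x1 \<in> edom \<phi>1 \<inter> V \<and> x2 \<in> edom \<phi>2 \<inter> V \<and> dist x1 x2 < \<eta>}"

definition diamond_limsup ::
    "('a::metric_space \<Rightarrow> ereal) \<Rightarrow> ('a \<Rightarrow> ereal) \<Rightarrow> 'a set \<Rightarrow> 'a set \<Rightarrow> ereal" where
  "diamond_limsup \<phi>1 \<phi>2 U V = Lim (at_right 0) (diamond_sup \<phi>1 \<phi>2 U V)"

lemma diamond_nonneg: "0 \<le> diamond \<phi>1 \<phi>2 U x1 x2"
  unfolding diamond_def by (intro INF_greatest) (simp add: le_max_iff_disj)

lemma diamond_sup_mono:
  assumes "\<eta> \<le> \<eta>'"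
  shows "diamond_sup \<phi>1 \<phi>2 U V \<eta> \<le> diamond_sup \<phi>1 \<phi>2 U V \<eta>'"
proof -
  have Sup0_mono: "Sup0 S \<le> Sup0 T" if "S \<subseteq> T" "\<And>t. t \<in> T \<Longrightarrow> 0 \<le> t" for S T :: "ereal set"
  proof (cases "S = {}")
    case True
    then show ?thesis
      using that(2) by (auto simp: Sup0_def ex_in_conv[symmetric] intro: Sup_upper2)
  next
    case False
    then show ?thesis
      using that(1) by (auto simp: Sup0_def intro: Sup_subset_mono)
  qed
  show ?thesis
    unfolding diamond_sup_def
    by (rule Sup0_mono) (use assms in \<open>auto intro: diamond_nonneg less_le_trans\<close>)
qed

lemma tendsto_diamond_limsup:
  "(diamond_sup \<phi>1 \<phi>2 U V \<longlongrightarrow> diamond_limsup \<phi>1 \<phi>2 U V) (at_right 0)"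
proof -
  let ?f = "diamond_sup \<phi>1 \<phi>2 U V"
  have "(?f \<longlongrightarrow> (INF \<eta>\<in>{0<..}. ?f \<eta>)) (at_right 0)"
  proof (rule order_tendstoI)
    fix a assume "a < (INF \<eta>\<in>{0<..}. ?f \<eta>)"
    then show "\<forall>\<^sub>F \<eta> in at_right 0. a < ?f \<eta>"
      unfolding eventually_at_right_field
      by (intro exI[of _ 1]) (auto intro: less_le_trans INF_lower)
  next
    fix a assume "(INF \<eta>\<in>{0<..}. ?f \<eta>) < a"
    then obtain b where "b > 0" "?f b < a"
      by (auto simp: INF_less_iff)
    then show "\<forall>\<^sub>F \<eta> in at_right 0. ?f \<eta> < a"
      unfolding eventually_at_right_field
      by (intro exI[of _ b]) (auto intro: le_less_trans diamond_sup_mono less_imp_le)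
  qed
  then show ?thesis
    unfolding diamond_limsup_def by (simp add: tendsto_Lim)
qed

definition Theta_circ ::
    "'a::metric_space set \<Rightarrow> ('a \<Rightarrow> ereal) \<Rightarrow> ('a \<Rightarrow> ereal) \<Rightarrow> ereal" where
  "Theta_circ U \<phi>1 \<phi>2 = diamond_limsup \<phi>1 \<phi>2 U U"

definition Theta_dagger ::
    "'a::metric_space set \<Rightarrow> ('a \<Rightarrow> ereal) \<Rightarrow> ('a \<Rightarrow> ereal) \<Rightarrow> ereal" where
  "Theta_dagger U \<phi>1 \<phi>2 = (SUP V\<in>EI U. diamond_limsup \<phi>1 \<phi>2 U V)"

definition firmly_uniformly_lsc ::
    "'a::metric_space set \<Rightarrow> ('a \<Rightarrow> ereal) \<Rightarrow> ('a \<Rightarrow> ereal) \<Rightarrow> bool" where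
  "firmly_uniformly_lsc U \<phi>1 \<phi>2 \<longleftrightarrow> Theta_circ U \<phi>1 \<phi>2 = 0"

definition firmly_quasiuniformly_lsc ::
    "'a::metric_space set \<Rightarrow> ('a \<Rightarrow> ereal) \<Rightarrow> ('a \<Rightarrow> ereal) \<Rightarrow> bool" where
  "firmly_quasiuniformly_lsc U \<phi>1 \<phi>2 \<longleftrightarrow> Theta_dagger U \<phi>1 \<phi>2 = 0"

text \<open>\<open>EI U\<close> always contains the empty set, so the supremum in \<open>Theta_dagger\<close> is never empty.\<close>

lemma empty_in_EI: "{} \<in> EI U"
  unfolding EI_def by (auto intro: exI[of _ 1])

end

theory Submission
  imports Defs
begin

text \<open>
  Both notions say that, for \<open>x1, x2\<close> close enough to each other, some \<open>x \<in> U\<close> makes all three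
  terms of the maximum in the diamond small. Adding \<open>g\<close> to \<open>\<phi>2\<close> leaves the two distances alone and
  changes the third term by \<open>g x - g x2\<close>. But \<open>x\<close> is already close to \<open>x2\<close>, because \<open>dist x x2\<close> is
  one of the terms being small, so uniform continuity of \<open>g\<close> makes this change small as well, and
  the same \<open>x\<close> serves for \<open>\<phi>2 + g\<close> (lemma \<open>diamond_add_less\<close>).

  Uniform continuity is only available on \<open>U\<close>, which is why \<open>x2 \<in> U\<close> is needed. Both points
  are taken from a set \<open>V\<close>, with \<open>V = U\<close> in the uniform case and \<open>V \<in> EI U\<close> in the quasiuniform
  case; in both cases \<open>V \<subseteq> U\<close>, so a single statement for a fixed \<open>V \<subseteq> U\<close> covers both
  (lemma \<open>diamond_limsup_add_eq_0\<close>). The limits are handled by an epsilon-eta characterization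
  of their vanishing (lemma \<open>diamond_limsup_eq_0_iff\<close>).
\<close>

text \<open>
  The convention that the empty supremum is \<open>0\<close> agrees with the nonnegativity of the diamond.
  Hence the limsup is nonnegative, and its vanishing amounts to upper bounds only.
\<close>

lemma diamond_sup_nonneg: "0 \<le> diamond_sup \<phi>1 \<phi>2 U V \<eta>"
proof -
  have "0 \<le> Sup0 S" if "\<And>s. s \<in> S \<Longrightarrow> 0 \<le> s" for S :: "ereal set"
    using that by (auto simp: Sup0_def ex_in_conv[symmetric] intro: Sup_upper2)
  then show ?thesis
    unfolding diamond_sup_def using diamond_nonneg by (smt (verit) mem_Collect_eq)
qed

lemma diamond_sup_le_iff:
  assumes "0 \<le> c"
  shows "diamond_sup \<phi>1 \<phi>2 U V \<eta> \<le> c \<longleftrightarrow>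
    (\<forall>x1\<in>edom \<phi>1 \<inter> V. \<forall>x2\<in>edom \<phi>2 \<inter> V. dist x1 x2 < \<eta> \<longrightarrow> diamond \<phi>1 \<phi>2 U x1 x2 \<le> c)"
  using assms unfolding diamond_sup_def Sup0_def by (auto simp: Sup_le_iff)

lemma diamond_limsup_nonneg: "0 \<le> diamond_limsup \<phi>1 \<phi>2 U V"
  by (rule tendsto_lowerbound[OF tendsto_diamond_limsup]) (auto simp: diamond_sup_nonneg)

lemma diamond_limsup_le_diamond_sup:
  assumes "0 < \<eta>"
  shows "diamond_limsup \<phi>1 \<phi>2 U V \<le> diamond_sup \<phi>1 \<phi>2 U V \<eta>"
proof (rule tendsto_upperbound[OF tendsto_diamond_limsup])
  show "\<forall>\<^sub>F \<eta>' in at_right 0. diamond_sup \<phi>1 \<phi>2 U V \<eta>' \<le> diamond_sup \<phi>1 \<phi>2 U V \<eta>"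
    using assms unfolding eventually_at_right_field
    by (auto intro!: exI[of _ \<eta>] diamond_sup_mono)
qed simp

lemma diamond_limsup_eq_0_iff:
  "diamond_limsup \<phi>1 \<phi>2 U V = 0 \<longleftrightarrow>
    (\<forall>\<epsilon>>0. \<exists>\<eta>>0. \<forall>x1\<in>edom \<phi>1 \<inter> V. \<forall>x2\<in>edom \<phi>2 \<inter> V.
       dist x1 x2 < \<eta> \<longrightarrow> diamond \<phi>1 \<phi>2 U x1 x2 < ereal \<epsilon>)"
  (is "?L \<longleftrightarrow> ?R")
proof
  assume ?L
  show ?R
  proof (intro allI impI)
    fix \<epsilon> :: real assume "0 < \<epsilon>"
    \<comment> \<open>Going through half of \<open>\<epsilon>\<close> turns the non-strict bound on the supremum into a strict one.\<close>
    have "\<forall>\<^sub>F \<eta> in at_right 0. diamond_sup \<phi>1 \<phi>2 U V \<eta> < ereal (\<epsilon> / 2)"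
      using order_tendstoD(2)[OF tendsto_diamond_limsup, of \<phi>1 \<phi>2 U V "ereal (\<epsilon> / 2)"] \<open>?L\<close> \<open>0 < \<epsilon>\<close>
      by simp
    then obtain b where "0 < b" and b: "\<And>\<eta>. 0 < \<eta> \<Longrightarrow> \<eta> < b \<Longrightarrow> diamond_sup \<phi>1 \<phi>2 U V \<eta> < ereal (\<epsilon> / 2)"
      unfolding eventually_at_right_field by auto
    then have "diamond_sup \<phi>1 \<phi>2 U V (b / 2) \<le> ereal (\<epsilon> / 2)"
      by (simp add: less_imp_le)
    moreover have "ereal (\<epsilon> / 2) < ereal \<epsilon>"
      using \<open>0 < \<epsilon>\<close> by simp
    moreover have "0 < b / 2" "0 \<le> ereal (\<epsilon> / 2)"
      using \<open>0 < b\<close> \<open>0 < \<epsilon>\<close> by simp_all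
    ultimately show "\<exists>\<eta>>0. \<forall>x1\<in>edom \<phi>1 \<inter> V. \<forall>x2\<in>edom \<phi>2 \<inter> V.
        dist x1 x2 < \<eta> \<longrightarrow> diamond \<phi>1 \<phi>2 U x1 x2 < ereal \<epsilon>"
      using diamond_sup_le_iff le_less_trans by blast
  qed
next
  assume R: ?R
  have "diamond_limsup \<phi>1 \<phi>2 U V \<le> 0"
  proof (rule ereal_le_epsilon2)
    fix \<epsilon> :: real assume "0 < \<epsilon>"
    with R obtain \<eta> where "0 < \<eta>" and "\<forall>x1\<in>edom \<phi>1 \<inter> V. \<forall>x2\<in>edom \<phi>2 \<inter> V.
        dist x1 x2 < \<eta> \<longrightarrow> diamond \<phi>1 \<phi>2 U x1 x2 < ereal \<epsilon>"
      by blast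
    then have "diamond_sup \<phi>1 \<phi>2 U V \<eta> \<le> ereal \<epsilon>"
      using \<open>0 < \<epsilon>\<close> by (subst diamond_sup_le_iff) (auto simp: less_imp_le)
    then show "diamond_limsup \<phi>1 \<phi>2 U V \<le> 0 + ereal \<epsilon>"
      using diamond_limsup_le_diamond_sup[OF \<open>0 < \<eta>\<close>, of \<phi>1 \<phi>2 U V] by simp
  qed
  then show ?L
    using diamond_limsup_nonneg by (rule antisym)
qed

lemma edom_add_real: "edom (\<lambda>x. \<phi> x + ereal (g x)) = edom \<phi>"
  unfolding edom_def by auto

lemma diamond_less_iff:
  "diamond \<phi>1 \<phi>2 U x1 x2 < c \<longleftrightarrow>
    (\<exists>x\<in>U. ereal (dist x x1) < c \<and> ereal (dist x x2) < c \<and>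
       (\<phi>1 x + \<phi>2 x) - \<phi>1 x1 - \<phi>2 x2 < c)"
  unfolding diamond_def by (auto simp: INF_less_iff)

text \<open>
  The bound \<open>\<delta>\<close> plays two roles: it bounds all terms of the diamond for \<open>\<phi>2\<close>, and through
  \<open>dist x x2 < \<delta>\<close> it places the point \<open>x\<close> found there where \<open>g x - g x2 < \<epsilon>'\<close>.
\<close>

lemma diamond_add_less:
  assumes less: "diamond \<phi>1 \<phi>2 U x1 x2 < ereal \<delta>"
    and g: "\<And>x. x \<in> U \<Longrightarrow> dist x x2 < \<delta> \<Longrightarrow> g x - g x2 < \<epsilon>'"
    and "0 \<le> \<epsilon>'"
    and fin: "\<bar>\<phi>1 x1\<bar> \<noteq> \<infinity>" "\<bar>\<phi>2 x2\<bar> \<noteq> \<infinity>"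
  shows "diamond \<phi>1 (\<lambda>x. \<phi>2 x + ereal (g x)) U x1 x2 < ereal (\<delta> + \<epsilon>')"
proof -
  obtain x where x: "x \<in> U" "dist x x1 < \<delta>" "dist x x2 < \<delta>"
    and val: "(\<phi>1 x + \<phi>2 x) - \<phi>1 x1 - \<phi>2 x2 < ereal \<delta>"
    using less unfolding diamond_less_iff by auto
  have "g x - g x2 < \<epsilon>'"
    using g x by blast
  then have "(\<phi>1 x + (\<phi>2 x + ereal (g x))) - \<phi>1 x1 - (\<phi>2 x2 + ereal (g x2)) < ereal (\<delta> + \<epsilon>')"
    using val fin
    by (cases "\<phi>1 x"; cases "\<phi>2 x"; cases "\<phi>1 x1"; cases "\<phi>2 x2") auto
  then show ?thesis
    using x \<open>0 \<le> \<epsilon>'\<close> unfolding diamond_less_iff by (intro bexI[of _ x]) auto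
qed

lemma diamond_limsup_add_eq_0:
  fixes \<phi>1 \<phi>2 :: "'a::metric_space \<Rightarrow> ereal" and g :: "'a \<Rightarrow> real"
  assumes proper: "\<And>x. \<phi>1 x \<noteq> -\<infinity>" "\<And>x. \<phi>2 x \<noteq> -\<infinity>"
    and g: "uniformly_continuous_on U g"
    and "V \<subseteq> U"
    and lim: "diamond_limsup \<phi>1 \<phi>2 U V = 0"
  shows "diamond_limsup \<phi>1 (\<lambda>x. \<phi>2 x + ereal (g x)) U V = 0"
  unfolding diamond_limsup_eq_0_iff edom_add_real
proof (intro allI impI)
  fix \<epsilon> :: real assume "0 < \<epsilon>"
  then have "0 < \<epsilon> / 2"
    by simp
  then obtain d where "0 < d"
    and d: "\<And>x y. x \<in> U \<Longrightarrow> y \<in> U \<Longrightarrow> dist x y < d \<Longrightarrow> dist (g x) (g y) < \<epsilon> / 2"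
    using g unfolding uniformly_continuous_on_def by (metis dist_commute)
  define \<delta> where "\<delta> = min d (\<epsilon> / 2)"
  have "0 < \<delta>"
    using \<open>0 < d\<close> \<open>0 < \<epsilon>\<close> by (simp add: \<delta>_def)
  then obtain \<eta> where "0 < \<eta>" and \<eta>: "\<forall>x1\<in>edom \<phi>1 \<inter> V. \<forall>x2\<in>edom \<phi>2 \<inter> V.
      dist x1 x2 < \<eta> \<longrightarrow> diamond \<phi>1 \<phi>2 U x1 x2 < ereal \<delta>"
    using lim unfolding diamond_limsup_eq_0_iff by blast
  have "diamond \<phi>1 (\<lambda>x. \<phi>2 x + ereal (g x)) U x1 x2 < ereal \<epsilon>"
    if x1: "x1 \<in> edom \<phi>1 \<inter> V" and x2: "x2 \<in> edom \<phi>2 \<inter> V" and "dist x1 x2 < \<eta>" for x1 x2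
  proof -
    have "x2 \<in> U"
      using x2 \<open>V \<subseteq> U\<close> by blast
    then have "g x - g x2 < \<epsilon> / 2" if "x \<in> U" "dist x x2 < \<delta>" for x
      using d[of x x2] that unfolding \<delta>_def dist_real_def by linarith
    moreover have "\<bar>\<phi>1 x1\<bar> \<noteq> \<infinity>" "\<bar>\<phi>2 x2\<bar> \<noteq> \<infinity>"
      using x1 x2 proper[of x1] proper[of x2] by (auto simp: edom_def)
    ultimately have "diamond \<phi>1 (\<lambda>x. \<phi>2 x + ereal (g x)) U x1 x2 < ereal (\<delta> + \<epsilon> / 2)"
      using diamond_add_less[OF \<eta>[rule_format, OF that]] \<open>0 < \<epsilon> / 2\<close> by (simp add: less_imp_le)
    also have "\<dots> \<le> ereal \<epsilon>"
      by (simp add: \<delta>_def)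
    finally show ?thesis .
  qed
  then show "\<exists>\<eta>>0. \<forall>x1\<in>edom \<phi>1 \<inter> V. \<forall>x2\<in>edom \<phi>2 \<inter> V.
      dist x1 x2 < \<eta> \<longrightarrow> diamond \<phi>1 (\<lambda>x. \<phi>2 x + ereal (g x)) U x1 x2 < ereal \<epsilon>"
    using \<open>0 < \<eta>\<close> by blast
qed

lemma EI_subset: "V \<in> EI U \<Longrightarrow> V \<subseteq> U"
  unfolding EI_def using centre_in_ball by blast

lemma firmly_quasiuniformly_lsc_iff:
  "firmly_quasiuniformly_lsc U \<phi>1 \<phi>2 \<longleftrightarrow> (\<forall>V\<in>EI U. diamond_limsup \<phi>1 \<phi>2 U V = 0)"
proof
  assume L: "firmly_quasiuniformly_lsc U \<phi>1 \<phi>2"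
  show "\<forall>V\<in>EI U. diamond_limsup \<phi>1 \<phi>2 U V = 0"
  proof
    fix V assume "V \<in> EI U"
    then have "diamond_limsup \<phi>1 \<phi>2 U V \<le> Theta_dagger U \<phi>1 \<phi>2"
      unfolding Theta_dagger_def by (rule SUP_upper)
    then show "diamond_limsup \<phi>1 \<phi>2 U V = 0"
      using L diamond_limsup_nonneg[of \<phi>1 \<phi>2 U V]
      by (simp add: firmly_quasiuniformly_lsc_def antisym)
  qed
next
  assume "\<forall>V\<in>EI U. diamond_limsup \<phi>1 \<phi>2 U V = 0"
  \<comment> \<open>Without a member of \<open>EI U\<close> the supremum would be \<open>-\<infinity>\<close>.\<close>
  moreover have "EI U \<noteq> {}"
    using empty_in_EI by blast
  ultimately show "firmly_quasiuniformly_lsc U \<phi>1 \<phi>2"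
    by (simp add: firmly_quasiuniformly_lsc_def Theta_dagger_def)
qed

theorem proposition4p7:
  fixes \<phi>1 \<phi>2 :: "'a::metric_space \<Rightarrow> ereal" and g :: "'a \<Rightarrow> real" and U :: "'a set"
  assumes "\<And>x. \<phi>1 x \<noteq> -\<infinity>" and "\<And>x. \<phi>2 x \<noteq> -\<infinity>"
    and "edom \<phi>1 \<inter> edom \<phi>2 \<inter> U \<noteq> {}"
    and "uniformly_continuous_on U g"
  shows "(firmly_uniformly_lsc U \<phi>1 \<phi>2 \<longrightarrow>
            firmly_uniformly_lsc U \<phi>1 (\<lambda>x. \<phi>2 x + ereal (g x))) \<and>
         (firmly_quasiuniformly_lsc U \<phi>1 \<phi>2 \<longrightarrow>
            firmly_quasiuniformly_lsc U \<phi>1 (\<lambda>x. \<phi>2 x + ereal (g x)))"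
proof -
  have "diamond_limsup \<phi>1 (\<lambda>x. \<phi>2 x + ereal (g x)) U V = 0"
    if "V \<subseteq> U" "diamond_limsup \<phi>1 \<phi>2 U V = 0" for V
    using diamond_limsup_add_eq_0[OF assms(1,2,4) that] .
  then show ?thesis
    unfolding firmly_uniformly_lsc_def Theta_circ_def firmly_quasiuniformly_lsc_iff
    by (simp add: EI_subset)
qed

end
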